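(* (1) For $d=9$, the sign patterns $\Sigma_{3,4,3}$ and $\Sigma_{2,4,4}$ are not realizable with the pair $(0,7)$. (2) For $d=10$, the sign pattern $\Sigma_{2,4,5}$ is not realizable with the pair $(0,8)$.
   Context: A sign pattern of length $d+1$ is a sequence of $d+1$ signs $+$ or $-$ beginning with a $+$. A real polynomial $P=x^d+a_{d-1}x^{d-1}+\cdots+a_1x+a_0$ with all $a_j\neq 0$ defines the sign pattern $(+,\mathrm{sgn}(a_{d-1}),\ldots,\mathrm{sgn}(a_1),\mathrm{sgn}(a_0))$. For integers $m,n,q\geq 1$ with $m+n+q=d+1$, $\Sigma_{m,n,q}$ denotes the sign pattern consisting of $m$ pluses followed by $n$ minuses followed by $q$ pluses. A sign pattern is realizable with a pair $(pos,neg)$ if there is a monic real polynomial of degree $d$ defining this sign pattern which has exactly $pos$ positive roots, all distinct (simple), and exactly $neg$ negative roots, all distinct (simple); the remaining roots are non-real. *)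

theory Defs
  imports Complex_Main "HOL-Computational_Algebra.Polynomial"
begin

text \<open>Signs are encoded as the values 1 and -1 of \<^const>\<open>sgn\<close> on the reals.
  Sign patterns list the signs of the coefficients from the leading one downwards.\<close>

definition is_sign_pattern :: "real list \<Rightarrow> bool" where
  "is_sign_pattern \<sigma> \<longleftrightarrow> \<sigma> \<noteq> [] \<and> set \<sigma> \<subseteq> {1, -1} \<and> hd \<sigma> = 1"

definition sign_pattern_of :: "real poly \<Rightarrow> real list" where
  "sign_pattern_of P = map sgn (rev (coeffs P))"

definition defines_sign_pattern :: "real poly \<Rightarrow> real list \<Rightarrow> bool" where
  "defines_sign_pattern P \<sigma> \<longleftrightarrow>
     lead_coeff P = 1 \<and> (\<forall>j\<le>degree P. coeff P j \<noteq> 0) \<and> sign_pattern_of P = \<sigma>"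

definition Sigma_pattern :: "nat \<Rightarrow> nat \<Rightarrow> nat \<Rightarrow> real list" where
  "Sigma_pattern m n q = replicate m 1 @ replicate n (-1) @ replicate q 1"

text \<open>The constant term of \<open>P\<close> is nonzero, so 0 is not a root and the roots not
  counted below are automatically non-real.\<close>

definition realizable :: "nat \<Rightarrow> real list \<Rightarrow> nat \<Rightarrow> nat \<Rightarrow> bool" where
  "realizable d \<sigma> pos neg \<longleftrightarrow>
     (\<exists>P :: real poly. degree P = d \<and> defines_sign_pattern P \<sigma> \<and>
        card {x. x > 0 \<and> poly P x = 0} = pos \<and>
        card {x. x < 0 \<and> poly P x = 0} = neg \<and>
        (\<forall>x. poly P x = 0 \<longrightarrow> order x P = 1))"

lemma is_sign_pattern_Sigma_pattern:
  assumes "m \<ge> 1"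
  shows "is_sign_pattern (Sigma_pattern m n q)"
  using assms by (cases m) (auto simp: is_sign_pattern_def Sigma_pattern_def)

lemma length_Sigma_pattern: "length (Sigma_pattern m n q) = m + n + q"
  by (simp add: Sigma_pattern_def)

lemma defines_sign_pattern_length:
  assumes "defines_sign_pattern P \<sigma>"
  shows "length \<sigma> = degree P + 1"
proof -
  have "P \<noteq> 0"
    using assms by (auto simp: defines_sign_pattern_def)
  then show ?thesis
    using assms
    by (auto simp: defines_sign_pattern_def sign_pattern_of_def length_coeffs_degree)
qed

lemma defines_sign_pattern_is_sign_pattern:
  assumes "defines_sign_pattern P \<sigma>"
  shows "is_sign_pattern \<sigma>"
proof -
  have P: "P \<noteq> 0" "lead_coeff P = 1" "\<And>j. j \<le> degree P \<Longrightarrow> coeff P j \<noteq> 0"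
    and \<sigma>: "\<sigma> = map sgn (rev (coeffs P))"
    using assms by (auto simp: defines_sign_pattern_def sign_pattern_of_def)
  have "set \<sigma> \<subseteq> {1, -1}"
    using P unfolding \<sigma> by (auto simp: coeffs_def sgn_real_def less_Suc_eq_le)
  moreover have "\<sigma> \<noteq> []" "hd \<sigma> = 1"
    using P by (simp_all add: \<sigma> hd_map hd_rev last_coeffs_eq_coeff_degree)
  ultimately show ?thesis by (simp add: is_sign_pattern_def)
qed

end

theory Submission
  imports Defs "HOL-Library.Quadratic_Discriminant"
begin

text \<open>
  A realizing polynomial factors as \<open>P = Q \<cdot> (x\<^sup>2 - b x + g\<^sup>2)\<close> with \<open>b < 2 g\<close>, where \<open>Q\<close> has
  only negative roots and degree \<open>n = d - 2\<close>. Writing \<open>q\<^sub>k\<close> for the coefficients of \<open>Q\<close> and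
  \<open>s\<^sub>k = g\<^sup>k q\<^sub>k / (n choose k)\<close>, a negative coefficient of \<open>P\<close> in degree \<open>k + 2\<close> forces
  \<open>(n choose k) s\<^sub>k + (n choose (k + 2)) s\<^bsub>k+2\<^esub> < 2 (n choose (k + 1)) s\<^bsub>k+1\<^esub>\<close>. Only the
  lowest and the highest of the four minus signs are needed. They involve six consecutive
  numbers \<open>A\<^sub>0, \<dots>, A\<^sub>5\<close> among the \<open>s\<^sub>k\<close>. Differentiation and reversal preserve
  real-rootedness, so consecutive \<open>s\<^sub>k\<close> are, up to binomial factors, the coefficients of
  real-rooted quadratics and quartics. This gives Newton's inequalities and the nonnegativity
  of the quartic invariant \<open>A\<^sub>0 A\<^sub>4 - 4 A\<^sub>1 A\<^sub>3 + 3 A\<^sub>2\<^sup>2\<close>. A suitable positive combination of the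
  two inequalities for \<open>P\<close>, made invariant under \<open>x \<mapsto> c x\<close> by the inequality between arithmetic
  and geometric means, contradicts these.
\<close>

section \<open>Real-rooted polynomials with positive coefficients\<close>

text \<open>Roots are counted without multiplicity, so they are all real and simple; positive
  coefficients make them negative. Simplicity turns Rolle's theorem into plain counting.\<close>

definition pos_real_rooted :: "real poly \<Rightarrow> bool" where
  "pos_real_rooted p \<longleftrightarrow>
     (\<forall>k\<le>degree p. coeff p k > 0) \<and> card {x. poly p x = 0} = degree p"

text \<open>This normalization makes differentiation a shift up to a constant factor and turns
  Newton's inequalities into log-concavity.\<close>

definition normalized_coeff :: "real poly \<Rightarrow> nat \<Rightarrow> real" where
  "normalized_coeff p k = coeff p k / real (degree p choose k)"

lemma normalized_coeff_pos:
  assumes "pos_real_rooted p" "k \<le> degree p"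
  shows "normalized_coeff p k > 0"
  using assms by (simp add: pos_real_rooted_def normalized_coeff_def)

section \<open>Stability under differentiation and reversal\<close>

text \<open>Rolle's theorem between neighbouring elements of \<open>A\<close>. Counting only
  critical points below \<open>Max A\<close> lets the induction add the largest element last: the
  new critical point lies above the old maximum and is not yet counted.\<close>

lemma card_roots_pderiv_ge:
  fixes p :: "real poly"
  assumes "pderiv p \<noteq> 0" "finite A" "\<And>x. x \<in> A \<Longrightarrow> poly p x = 0" "A \<noteq> {}"
  shows "card A - 1 \<le> card {x. x < Max A \<and> poly (pderiv p) x = 0}"
  using assms(2-4)
proof (induction A rule: finite_linorder_max_induct)
  case empty
  then show ?case by simp
next
  case (insert b A)
  have fin: "finite {x. x < c \<and> poly (pderiv p) x = 0}" for c
    using poly_roots_finite[OF assms(1)] by (rule rev_finite_subset) auto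
  show ?case
  proof (cases "A = {}")
    case False
    have "Max A < b" using insert.hyps False by simp
    moreover have "poly p (Max A) = 0" "poly p b = 0"
      using insert.prems insert.hyps(1) False by auto
    ultimately obtain z where z: "Max A < z" "z < b" "poly (pderiv p) z = 0"
      using poly_MVT[of "Max A" b p] by auto
    have "card A = Suc (card A - 1)"
      using insert.hyps(1) False by (simp add: card_gt_0_iff)
    also have "\<dots> \<le> Suc (card {x. x < Max A \<and> poly (pderiv p) x = 0})"
      using insert.IH insert.prems False by simp
    also have "\<dots> = card (insert z {x. x < Max A \<and> poly (pderiv p) x = 0})"
      using fin z by simp
    also have "\<dots> \<le> card {x. x < b \<and> poly (pderiv p) x = 0}"
      using z by (intro card_mono fin) auto
    finally have "card A \<le> card {x. x < b \<and> poly (pderiv p) x = 0}" .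
    moreover have "Max (insert b A) = b"
      using insert.hyps by (intro Max_eqI) (auto intro: less_imp_le)
    moreover have "b \<notin> A" using insert.hyps by auto
    ultimately show ?thesis using insert.hyps(1) by simp
  qed auto
qed

lemma pos_real_rooted_pderiv:
  assumes "pos_real_rooted p" "degree p > 0"
  shows "pos_real_rooted (pderiv p)"
proof -
  let ?A = "{x. poly p x = 0}"
  have nz: "pderiv p \<noteq> 0" using assms(2) by (simp add: pderiv_eq_0_iff)
  have cA: "card ?A = degree p" using assms(1) by (simp add: pos_real_rooted_def)
  have A: "finite ?A" "?A \<noteq> {}"
    using assms(2) cA card_gt_0_iff[of ?A] by simp_all
  have "degree p - 1 \<le> card {x. x < Max ?A \<and> poly (pderiv p) x = 0}"
    using card_roots_pderiv_ge[OF nz A(1) _ A(2)] cA by auto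
  also have "\<dots> \<le> card {x. poly (pderiv p) x = 0}"
    by (intro card_mono poly_roots_finite[OF nz]) auto
  finally have "card {x. poly (pderiv p) x = 0} = degree (pderiv p)"
    using card_poly_roots_bound[OF nz] by (simp add: degree_pderiv)
  moreover have "coeff (pderiv p) k > 0" if "k \<le> degree (pderiv p)" for k
    using that assms by (auto simp: degree_pderiv coeff_pderiv pos_real_rooted_def)
  ultimately show ?thesis by (simp add: pos_real_rooted_def)
qed

lemma normalized_coeff_pderiv:
  assumes "k < degree p"
  shows "normalized_coeff (pderiv p) k = real (degree p) * normalized_coeff p (Suc k)"
proof -
  obtain m where m: "degree p = Suc m" using assms by (cases "degree p") auto
  have "real (Suc k) * real (Suc m choose Suc k) = real (Suc m) * real (m choose k)"
    by (simp only: of_nat_mult[symmetric] Suc_times_binomial)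
  moreover have "m choose k > 0" "Suc m choose Suc k > 0" using assms m by auto
  ultimately show ?thesis
    unfolding normalized_coeff_def degree_pderiv coeff_pderiv m
    by (simp add: divide_simps del: binomial_Suc_Suc of_nat_Suc)
qed

lemma pos_real_rooted_reflect:
  assumes "pos_real_rooted p"
  shows "pos_real_rooted (reflect_poly p)" "degree (reflect_poly p) = degree p"
proof -
  have c0: "coeff p 0 > 0" using assms by (simp add: pos_real_rooted_def)
  show deg: "degree (reflect_poly p) = degree p" using c0 by simp
  have c1: "coeff (reflect_poly p) 0 \<noteq> 0"
    using assms c0 by (auto simp: pos_real_rooted_def)
  have nz: "x \<noteq> 0" if "poly q x = 0" "coeff q 0 \<noteq> 0" for q :: "real poly" and x
    using that by (auto simp: poly_0_coeff_0)
  have "bij_betw inverse {x. poly (reflect_poly p) x = 0} {x. poly p x = 0}"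
  proof (rule bij_betw_byWitness[where f' = inverse])
    have "poly p (inverse x) = 0" if "poly (reflect_poly p) x = 0" for x
      using nz[OF that c1] that poly_reflect_poly_nz[of x p] by simp
    then show "inverse ` {x. poly (reflect_poly p) x = 0} \<subseteq> {x. poly p x = 0}" by blast
    have "poly (reflect_poly p) (inverse x) = 0" if "poly p x = 0" for x
    proof -
      have "inverse x \<noteq> 0" using nz[OF that] c0 by simp
      then show ?thesis using that poly_reflect_poly_nz[of "inverse x" p] by simp
    qed
    then show "inverse ` {x. poly p x = 0} \<subseteq> {x. poly (reflect_poly p) x = 0}" by blast
  qed simp_all
  then have "card {x. poly (reflect_poly p) x = 0} = card {x. poly p x = 0}"
    by (rule bij_betw_same_card)
  then show "pos_real_rooted (reflect_poly p)"
    using assms deg by (simp add: pos_real_rooted_def coeff_reflect_poly)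
qed

lemma normalized_coeff_reflect:
  assumes "pos_real_rooted p" "k \<le> degree p"
  shows "normalized_coeff (reflect_poly p) k = normalized_coeff p (degree p - k)"
  using assms pos_real_rooted_reflect(2)[OF assms(1)]
  by (simp add: normalized_coeff_def coeff_reflect_poly binomial_symmetric[of k])

section \<open>Newton and quartic inequalities for consecutive coefficients\<close>

lemma window_low:
  assumes "pos_real_rooted p" "k \<le> degree p"
  shows "\<exists>r c. pos_real_rooted r \<and> degree r = degree p - k \<and> c > 0 \<and>
           (\<forall>j\<le>degree r. normalized_coeff r j = c * normalized_coeff p (k + j))"
  using assms(2)
proof (induction k)
  case 0
  then show ?case using assms(1) by (intro exI[of _ p] exI[of _ 1]) auto
next
  case (Suc k)
  then obtain r c where r: "pos_real_rooted r" "degree r = degree p - k" "c > 0"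
    "\<forall>j\<le>degree r. normalized_coeff r j = c * normalized_coeff p (k + j)"
    by auto
  have d: "degree r > 0" using r(2) Suc.prems by simp
  show ?case
    using r d Suc.prems pos_real_rooted_pderiv[OF r(1) d]
    by (intro exI[of _ "pderiv r"] exI[of _ "real (degree r) * c"])
      (auto simp: normalized_coeff_pderiv degree_pderiv)
qed

text \<open>Differentiating drops the lowest coefficients; reversing, differentiating and reversing
  back drops the highest ones.\<close>

lemma window:
  assumes "pos_real_rooted p" "k + m \<le> degree p"
  obtains r c where "pos_real_rooted r" "degree r = m" "c > 0"
    "\<And>j. j \<le> m \<Longrightarrow> normalized_coeff r j = c * normalized_coeff p (k + j)"
proof -
  obtain r1 c1 where r1: "pos_real_rooted r1" "degree r1 = degree p - k" "c1 > 0"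
    "\<And>j. j \<le> degree r1 \<Longrightarrow> normalized_coeff r1 j = c1 * normalized_coeff p (k + j)"
    using window_low[OF assms(1), of k] assms(2) by auto
  let ?h = "degree r1 - m"
  obtain r2 c2 where r2: "pos_real_rooted r2" "degree r2 = m" "c2 > 0"
    "\<And>j. j \<le> m \<Longrightarrow>
      normalized_coeff r2 j = c2 * normalized_coeff (reflect_poly r1) (?h + j)"
  proof -
    have "degree (reflect_poly r1) - ?h = m"
      using assms(2) r1(2) pos_real_rooted_reflect(2)[OF r1(1)] by simp
    then show ?thesis
      using that window_low[OF pos_real_rooted_reflect(1)[OF r1(1)], of ?h]
        pos_real_rooted_reflect(2)[OF r1(1)] by (metis diff_le_self)
  qed
  have "normalized_coeff (reflect_poly r2) j = c2 * c1 * normalized_coeff p (k + j)"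
    if "j \<le> m" for j
  proof -
    have "degree r1 - (?h + (m - j)) = j" using that assms(2) r1(2) by simp
    then show ?thesis
      using that assms(2) r1 r2 by (simp add: normalized_coeff_reflect)
  qed
  then show thesis
    using that[of "reflect_poly r2" "c2 * c1"] r1(3) r2(1-3)
      pos_real_rooted_reflect[OF r2(1)] by simp
qed

text \<open>A window of three coefficients is a quadratic with a real root, so its discriminant is
  nonnegative.\<close>

lemma newton_inequality:
  assumes "pos_real_rooted p" "k + 2 \<le> degree p"
  shows "normalized_coeff p k * normalized_coeff p (k + 2) \<le> (normalized_coeff p (k + 1))\<^sup>2"
proof -
  obtain r c where r: "pos_real_rooted r" "degree r = 2" "c > 0"
    "\<And>j. j \<le> 2 \<Longrightarrow> normalized_coeff r j = c * normalized_coeff p (k + j)"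
    using window[OF assms] by blast
  have "card {x. poly r x = 0} \<noteq> 0" using r(1,2) by (simp add: pos_real_rooted_def)
  then obtain x where x: "poly r x = 0" by (metis (mono_tags) card.empty Collect_empty_eq)
  have "coeff r 2 * x\<^sup>2 + coeff r 1 * x + coeff r 0 = 0"
    using x r(2) by (simp add: poly_altdef eval_nat_numeral algebra_simps)
  moreover have "coeff r 2 \<noteq> 0" using r(1,2) by (auto simp: pos_real_rooted_def)
  ultimately have "discrim (coeff r 2) (coeff r 1) (coeff r 0) \<ge> 0"
    using discriminant_negative[of "coeff r 2" "coeff r 1" "coeff r 0" x] by force
  moreover have "coeff r 0 = c * normalized_coeff p k"
    "coeff r 1 = 2 * c * normalized_coeff p (k + 1)"
    "coeff r 2 = c * normalized_coeff p (k + 2)"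
    using r(4)[of 0] r(4)[of 1] r(4)[of 2] r(2) by (auto simp: normalized_coeff_def)
  ultimately have "0 \<le> 4 * c\<^sup>2 * ((normalized_coeff p (k + 1))\<^sup>2
      - normalized_coeff p k * normalized_coeff p (k + 2))"
    by (simp add: discrim_def power2_eq_square algebra_simps)
  then show ?thesis using r(3) by (simp add: zero_le_mult_iff)
qed

text \<open>This is the invariant of degree two of a binary quartic; in terms of the roots it is a
  positive multiple of a sum of three squares.\<close>

lemma quartic_invariant_nonneg:
  fixes r :: "real poly"
  assumes "degree r = 4" "card {x. poly r x = 0} = 4"
  shows "0 \<le> 12 * coeff r 0 * coeff r 4 - 3 * coeff r 1 * coeff r 3 + (coeff r 2)\<^sup>2"
proof -
  obtain a b c d where abcd: "{x. poly r x = 0} = {a, b, c, d}"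
    using assms(2) by (auto simp: eval_nat_numeral card_Suc_eq)
  define l where "l = coeff r 4"
  let ?q = "[:l*a*b*c*d, -l*(a*b*c+a*b*d+a*c*d+b*c*d), l*(a*b+a*c+a*d+b*c+b*d+c*d),
              -l*(a+b+c+d), l:]"
  have zero: "poly ?q z = l * (z - a) * (z - b) * (z - c) * (z - d)" for z
    by (simp add: algebra_simps)
  have r: "r = ?q"
  \<comment> \<open>Both polynomials vanish at the four roots and have the same coefficient in
    degree 4.\<close>
  proof (rule poly_eqI_degree_lead_coeff[where n = 4 and A = "{x. poly r x = 0}"])
    show "poly r z = poly ?q z" if "z \<in> {x. poly r x = 0}" for z
      using that abcd unfolding zero by auto
  qed (use assms in \<open>auto simp: l_def eval_nat_numeral\<close>)
  have "12 * (l*a*b*c*d) * l - 3 * (-l*(a*b*c+a*b*d+a*c*d+b*c*d)) * (-l*(a+b+c+d))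
      + (l*(a*b+a*c+a*d+b*c+b*d+c*d))\<^sup>2 =
      l\<^sup>2 * (((a-b)*(c-d))\<^sup>2 + ((a-c)*(b-d))\<^sup>2 + ((a-d)*(b-c))\<^sup>2) / 2"
    by (simp add: field_simps power2_eq_square)
  also have "\<dots> \<ge> 0" by simp
  finally have nonneg: "0 \<le> 12 * (l*a*b*c*d) * l
      - 3 * (-l*(a*b*c+a*b*d+a*c*d+b*c*d)) * (-l*(a+b+c+d))
      + (l*(a*b+a*c+a*d+b*c+b*d+c*d))\<^sup>2" .
  have coeffs: "coeff r 0 = l*a*b*c*d" "coeff r 1 = -l*(a*b*c+a*b*d+a*c*d+b*c*d)"
    "coeff r 2 = l*(a*b+a*c+a*d+b*c+b*d+c*d)" "coeff r 3 = -l*(a+b+c+d)" "coeff r 4 = l"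
    by (subst r, simp add: eval_nat_numeral)+
  show ?thesis unfolding coeffs by (rule nonneg)
qed

lemma quartic_inequality:
  assumes "pos_real_rooted p" "k + 4 \<le> degree p"
  shows "4 * normalized_coeff p (k + 1) * normalized_coeff p (k + 3)
      - 3 * (normalized_coeff p (k + 2))\<^sup>2 \<le> normalized_coeff p k * normalized_coeff p (k + 4)"
proof -
  obtain r c where r: "pos_real_rooted r" "degree r = 4" "c > 0"
    "\<And>j. j \<le> 4 \<Longrightarrow> normalized_coeff r j = c * normalized_coeff p (k + j)"
    using window[OF assms] by blast
  have bin: "(4::nat) choose 2 = 6" "(4::nat) choose 3 = 4" by code_simp+
  have "coeff r 0 = c * normalized_coeff p k"
    "coeff r 1 = 4 * c * normalized_coeff p (k + 1)"
    "coeff r 2 = 6 * c * normalized_coeff p (k + 2)"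
    "coeff r 3 = 4 * c * normalized_coeff p (k + 3)"
    "coeff r 4 = c * normalized_coeff p (k + 4)"
    using r(4)[of 0] r(4)[of 1] r(4)[of 2] r(4)[of 3] r(4)[of 4] r(2) bin
    by (auto simp: normalized_coeff_def)
  moreover have "0 \<le> 12 * coeff r 0 * coeff r 4 - 3 * coeff r 1 * coeff r 3 + (coeff r 2)\<^sup>2"
    using r(1,2) by (intro quartic_invariant_nonneg) (auto simp: pos_real_rooted_def)
  ultimately have "0 \<le> 12 * c\<^sup>2 * (normalized_coeff p k * normalized_coeff p (k + 4)
      - 4 * normalized_coeff p (k + 1) * normalized_coeff p (k + 3)
      + 3 * (normalized_coeff p (k + 2))\<^sup>2)"
    by (simp add: power2_eq_square algebra_simps)
  then show ?thesis using r(3) by (simp add: zero_le_mult_iff)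
qed

lemma prod_linear_pos_real_rooted:
  fixes A :: "real set"
  assumes "finite A" "\<And>x. x \<in> A \<Longrightarrow> x < 0"
  defines "Q \<equiv> (\<Prod>x\<in>A. [:-x, 1:])"
  shows "pos_real_rooted Q" "degree Q = card A" "\<And>x. poly Q x = 0 \<longleftrightarrow> x \<in> A" "lead_coeff Q = 1"
proof -
  show deg: "degree Q = card A"
    unfolding Q_def by (subst degree_prod_eq_sum_degree) auto
  show roots: "\<And>x. poly Q x = 0 \<longleftrightarrow> x \<in> A"
    using assms(1) by (auto simp: Q_def poly_prod)
  show "lead_coeff Q = 1" by (simp add: Q_def lead_coeff_prod)
  have "\<forall>k\<le>card A. coeff (\<Prod>x\<in>A. [:-x, 1:]) k > 0"
    using assms(1,2)
  proof (induction A rule: finite_induct)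
    case (insert y A)
    let ?q = "\<Prod>x\<in>A. [:-x, 1:]"
    have dq: "degree ?q = card A" by (subst degree_prod_eq_sum_degree) auto
    have y: "- y > 0" using insert.prems by simp
    have nonneg: "coeff ?q k \<ge> 0" for k
      using insert.IH insert.prems dq by (cases "k \<le> card A") (auto simp: coeff_eq_0 less_imp_le)
    have c: "coeff (\<Prod>x\<in>insert y A. [:-x, 1:]) k =
        (- y) * coeff ?q k + (if k = 0 then 0 else coeff ?q (k - 1))" for k
      using insert.hyps by (cases k) auto
    show ?case
    proof (intro allI impI)
      fix k assume k: "k \<le> card (insert y A)"
      show "coeff (\<Prod>x\<in>insert y A. [:-x, 1:]) k > 0"
      proof (cases k)
        case 0
        then show ?thesis
          unfolding c using insert.IH insert.prems mult_pos_pos[OF y] by auto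
      next
        case (Suc j)
        then have "coeff ?q j > 0" using k insert.hyps insert.IH insert.prems by auto
        moreover have "(- y) * coeff ?q k \<ge> 0" using y nonneg by (intro mult_nonneg_nonneg) auto
        ultimately show ?thesis unfolding c using Suc by simp
      qed
    qed
  qed simp
  then show "pos_real_rooted Q"
    using deg roots by (simp add: pos_real_rooted_def Q_def)
qed

section \<open>Realizing polynomials without positive roots\<close>

lemma coeff_sgn_of_pattern:
  assumes "defines_sign_pattern P \<sigma>" "k \<le> degree P"
  shows "sgn (coeff P k) = \<sigma> ! (degree P - k)"
proof -
  have nz: "P \<noteq> 0" using assms(1) by (auto simp: defines_sign_pattern_def)
  have "\<sigma> = map sgn (rev (coeffs P))"
    using assms(1) by (simp add: defines_sign_pattern_def sign_pattern_of_def)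
  then show ?thesis
    using assms(2) nz by (simp add: rev_nth length_coeffs_degree coeffs_nth)
qed

lemma monic_quadratic:
  fixes R :: "real poly"
  assumes "degree R = 2" "lead_coeff R = 1" "\<And>x. poly R x \<noteq> 0"
  obtains b g where "R = [:g\<^sup>2, -b, 1:]" "g > 0" "b < 2 * g"
proof -
  obtain d e where R: "R = [:d, e, 1:]"
  proof
    show "R = [:coeff R 0, coeff R 1, 1:]"
    proof (rule poly_eqI)
      fix k :: nat
      consider "k = 0" | "k = 1" | "k = 2" | "k > 2" by linarith
      then show "coeff R k = coeff [:coeff R 0, coeff R 1, 1:] k"
        using assms(1,2) by cases (auto simp: eval_nat_numeral coeff_eq_0)
    qed
  qed
  have lt: "discrim 1 e d < 0"
  proof (rule ccontr)
    assume "\<not> ?thesis"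
    then have "\<exists>x. 1 * x\<^sup>2 + e * x + d = 0" by (intro discriminant_nonneg_ex) simp_all
    then obtain x where "x\<^sup>2 + e * x + d = 0" by auto
    then have "poly R x = 0" by (simp add: R power2_eq_square algebra_simps)
    with assms(3) show False by blast
  qed
  have "e\<^sup>2 < 4 * d" using lt by (simp add: discrim_def)
  moreover from this have "d > 0" using zero_le_power2[of e] by linarith
  ultimately have g: "sqrt d > 0" "(sqrt d)\<^sup>2 = d" "(- e)\<^sup>2 < (2 * sqrt d)\<^sup>2"
    by (simp_all add: power_mult_distrib)
  have "- e < 2 * sqrt d"
    using g(1) by (intro power_less_imp_less_base[OF g(3)]) linarith
  moreover have "R = [:(sqrt d)\<^sup>2, - (- e), 1:]" by (simp only: R g(2) minus_minus)
  ultimately show thesis using that g(1) by blast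
qed

lemma realizable_factorization:
  assumes "realizable (n + 2) \<sigma> 0 n" "n > 0"
  obtains Q b g where "pos_real_rooted Q" "degree Q = n" "g > 0" "b < 2 * g"
    "\<And>k. k \<le> n + 2 \<Longrightarrow> sgn (coeff (Q * [:g\<^sup>2, -b, 1:]) k) = \<sigma> ! (n + 2 - k)"
proof -
  obtain P where P: "degree P = n + 2" "defines_sign_pattern P \<sigma>"
    "card {x. x > 0 \<and> poly P x = 0} = 0" "card {x. x < 0 \<and> poly P x = 0} = n"
    "\<And>x. poly P x = 0 \<Longrightarrow> order x P = 1"
    using assms(1) unfolding realizable_def by blast
  have nz: "P \<noteq> 0" using P(1) by auto
  define A where "A = {x. x < 0 \<and> poly P x = 0}"
  define Q where "Q = (\<Prod>x\<in>A. [:-x, 1:])"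
  have finA: "finite A" using assms(2) P(4) unfolding A_def by (intro card_ge_0_finite) auto
  note Q = prod_linear_pos_real_rooted[of A, folded Q_def, OF finA]
  have Q1: "pos_real_rooted Q" "degree Q = n" "\<And>x. poly Q x = 0 \<longleftrightarrow> x \<in> A" "lead_coeff Q = 1"
    using Q P(4) by (auto simp: A_def)
  have Qnz: "Q \<noteq> 0" using Q1 assms(2) by auto
  \<comment> \<open>The remainder has degree below \<open>n\<close> but vanishes at the
    \<open>n\<close> negative roots.\<close>
  have "P mod Q = 0"
  proof (rule poly_eqI_degree[of A])
    show "poly (P mod Q) x = poly 0 x" if "x \<in> A" for x
    proof -
      have "poly P x = poly (P div Q * Q + P mod Q) x" by simp
      also have "\<dots> = poly (P mod Q) x"
        using that Q1(3)[of x] by (simp only: poly_add poly_mult) simp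
      finally show ?thesis using that by (simp add: A_def)
    qed
    show "card A > degree (P mod Q)"
      using degree_mod_less[OF Qnz, of P] Q1(2) P(4) assms(2) by (auto simp: A_def)
    show "card A > degree (0 :: real poly)" using P(4) assms(2) by (simp add: A_def)
  qed
  then obtain R where PQ: "P = Q * R" by (auto simp: mod_eq_0_iff_dvd)
  have Rnz: "R \<noteq> 0" using PQ nz by auto
  have degR: "degree R = 2"
    using P(1) Q1(2) Qnz Rnz unfolding PQ by (simp add: degree_mult_eq)
  have leadR: "lead_coeff R = 1"
    using P(2) Q1(4) unfolding PQ defines_sign_pattern_def by (simp add: lead_coeff_mult)
  \<comment> \<open>A real root of \<open>R\<close> would be negative, hence also a root of
    \<open>Q\<close>, and so a multiple root of \<open>P\<close>.\<close>
  have noroot: "poly R x \<noteq> 0" for x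
  proof
    assume x: "poly R x = 0"
    then have Px: "poly P x = 0" by (simp add: PQ)
    have "finite {x. x > 0 \<and> poly P x = 0}"
      using poly_roots_finite[OF nz] by (rule rev_finite_subset) auto
    then have "\<not> x > 0" using P(3) Px by auto
    moreover have "x \<noteq> 0"
      using P(2) Px by (auto simp: defines_sign_pattern_def poly_0_coeff_0)
    ultimately have "poly Q x = 0" using Px Q1(3) by (simp add: A_def)
    then have "order x Q \<noteq> 0" "order x R \<noteq> 0" using x Qnz Rnz by (auto simp: order_root)
    moreover have "order x P = order x Q + order x R"
      using nz unfolding PQ by (rule order_mult)
    ultimately show False using P(5)[OF Px] by simp
  qed
  obtain b g where R: "R = [:g\<^sup>2, -b, 1:]" "g > 0" "b < 2 * g"
    using monic_quadratic[OF degR leadR noroot] .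
  show thesis
    using that[OF Q1(1,2) R(2,3)] coeff_sgn_of_pattern[OF P(2)] P(1) PQ R(1) by auto
qed

lemma realizable_sequence:
  assumes "realizable (n + 2) \<sigma> 0 n" "n > 0"
  obtains s :: "nat \<Rightarrow> real" where
    "\<And>k. k \<le> n \<Longrightarrow> s k > 0"
    "\<And>k. k + 2 \<le> n \<Longrightarrow> s k * s (k + 2) \<le> (s (k + 1))\<^sup>2"
    "\<And>k. k + 4 \<le> n \<Longrightarrow> 4 * s (k + 1) * s (k + 3) - 3 * (s (k + 2))\<^sup>2 \<le> s k * s (k + 4)"
    "\<And>k. k + 2 \<le> n \<Longrightarrow> \<sigma> ! (n - k) = -1 \<Longrightarrow>
       real (n choose k) * s k + real (n choose (k + 2)) * s (k + 2)
         < 2 * real (n choose (k + 1)) * s (k + 1)"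
proof -
  obtain Q b g where Q: "pos_real_rooted Q" "degree Q = n" "g > 0" "b < 2 * g"
    "\<And>k. k \<le> n + 2 \<Longrightarrow> sgn (coeff (Q * [:g\<^sup>2, -b, 1:]) k) = \<sigma> ! (n + 2 - k)"
    by (rule realizable_factorization[OF assms]) blast
  \<comment> \<open>The powers of \<open>g\<close> come from the substitution of \<open>g x\<close>
    for \<open>x\<close>, which scales the constant term of the quadratic factor to 1.\<close>
  define s where "s k = g ^ k * normalized_coeff Q k" for k
  show thesis
  proof (rule that)
    show "s k > 0" if "k \<le> n" for k
      using that Q normalized_coeff_pos[OF Q(1), of k] by (simp add: s_def)
  next
    fix k assume k: "k + 2 \<le> n"
    have "(g ^ k * g)\<^sup>2 * (normalized_coeff Q k * normalized_coeff Q (k + 2))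
        \<le> (g ^ k * g)\<^sup>2 * (normalized_coeff Q (k + 1))\<^sup>2"
      using newton_inequality[OF Q(1), of k] k Q(2,3) by (intro mult_left_mono) auto
    then show "s k * s (k + 2) \<le> (s (k + 1))\<^sup>2"
      by (simp add: s_def power2_eq_square power_add mult_ac)
  next
    fix k assume k: "k + 4 \<le> n"
    have "(g ^ k * g\<^sup>2)\<^sup>2 * (4 * normalized_coeff Q (k + 1) * normalized_coeff Q (k + 3)
          - 3 * (normalized_coeff Q (k + 2))\<^sup>2)
        \<le> (g ^ k * g\<^sup>2)\<^sup>2 * (normalized_coeff Q k * normalized_coeff Q (k + 4))"
      using quartic_inequality[OF Q(1), of k] k Q(2,3) by (intro mult_left_mono) auto
    then show "4 * s (k + 1) * s (k + 3) - 3 * (s (k + 2))\<^sup>2 \<le> s k * s (k + 4)"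
      by (simp add: s_def eval_nat_numeral algebra_simps power_add)
  next
    fix k assume k: "k + 2 \<le> n" "\<sigma> ! (n - k) = -1"
    have coeff: "real (n choose j) * s j = g ^ j * coeff Q j" if "j \<le> n" for j
      using that Q(2) by (simp add: s_def normalized_coeff_def)
    \<comment> \<open>Patterns start at the leading coefficient, so degree \<open>k + 2\<close> sits
      at position \<open>(n + 2) - (k + 2) = n - k\<close>.\<close>
    have "sgn (coeff (Q * [:g\<^sup>2, -b, 1:]) (k + 2)) = -1"
      using Q(5)[of "k + 2"] k by simp
    then have "coeff (Q * [:g\<^sup>2, -b, 1:]) (k + 2) < 0"
      by (simp add: sgn_real_def split: if_splits)
    then have neg: "g\<^sup>2 * coeff Q (k + 2) - b * coeff Q (k + 1) + coeff Q k < 0"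
      by (simp add: mult.commute[of Q] numeral_2_eq_2)
    have "coeff Q (k + 1) > 0" using Q(1,2) k by (simp add: pos_real_rooted_def)
    then have "b * coeff Q (k + 1) < 2 * g * coeff Q (k + 1)"
      using Q(4) by simp
    with neg have "g\<^sup>2 * coeff Q (k + 2) + coeff Q k < 2 * g * coeff Q (k + 1)" by simp
    then have "g ^ k * (g\<^sup>2 * coeff Q (k + 2) + coeff Q k) < g ^ k * (2 * g * coeff Q (k + 1))"
      using Q(3) by simp
    then show "real (n choose k) * s k + real (n choose (k + 2)) * s (k + 2)
         < 2 * real (n choose (k + 1)) * s (k + 1)"
      using k coeff[of k] coeff[of "k + 1"] coeff[of "k + 2"]
      by (simp add: algebra_simps power2_eq_square del: binomial_Suc_Suc)
  qed
qed

section \<open>The inequality for six consecutive coefficients\<close>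

text \<open>
  In terms of \<open>p = A\<^sub>2\<^sup>2 / (A\<^sub>1 A\<^sub>3)\<close>, \<open>q = A\<^sub>3\<^sup>2 / (A\<^sub>2 A\<^sub>4)\<close>, \<open>t = A\<^sub>3 / A\<^sub>4\<close> and \<open>w = A\<^sub>2 / A\<^sub>1\<close>,
  the quartic inequalities read \<open>(4 - 3 p) t \<le> A\<^sub>0 / A\<^sub>1\<close> and \<open>(4 - 3 q) w \<le> A\<^sub>5 / A\<^sub>4\<close>. Since
  \<open>t w = p q\<close>, the terms of weight \<open>-1\<close> and those of weight \<open>1\<close> under \<open>x \<mapsto> c x\<close> have a product
  that is bounded below by a function of \<open>p\<close> times a function of \<open>q\<close>.
\<close>

lemma six_term_bound:
  fixes A0 A1 A2 A3 A4 A5 \<alpha> \<beta> \<gamma> \<delta> m c c' :: real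
  assumes A: "A0 > 0" "A1 > 0" "A2 > 0" "A3 > 0" "A4 > 0" "A5 > 0"
    and newton: "A1 * A3 \<le> A2\<^sup>2" "A2 * A4 \<le> A3\<^sup>2"
    and quartic: "4 * A1 * A3 - 3 * A2\<^sup>2 \<le> A0 * A4" "4 * A2 * A4 - 3 * A3\<^sup>2 \<le> A1 * A5"
    and weights: "\<alpha> \<ge> 0" "\<beta> \<ge> 0" "\<gamma> \<ge> 0" "\<delta> \<ge> 0"
    and p_bound: "\<And>p. p \<ge> 1 \<Longrightarrow> c \<le> p * max (\<alpha> * (4 - 3 * p) + \<beta>) \<beta>"
    and q_bound: "\<And>q. q \<ge> 1 \<Longrightarrow> c' \<le> q * max (\<gamma> + \<delta> * (4 - 3 * q)) \<gamma>"
    and c: "0 \<le> c" "0 \<le> c'" "m\<^sup>2 \<le> c * c'"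
  shows "2 * m \<le> (\<alpha> * A0 + \<gamma> * A2) / A1 + (\<beta> * A3 + \<delta> * A5) / A4"
proof -
  define e w t f where "e = A0 / A1" and "w = A2 / A1" and "t = A3 / A4" and "f = A5 / A4"
  define p q where "p = A2\<^sup>2 / (A1 * A3)" and "q = A3\<^sup>2 / (A2 * A4)"
  have pos: "e > 0" "w > 0" "t > 0" "f > 0" using A by (simp_all add: e_def w_def t_def f_def)
  have pq: "p \<ge> 1" "q \<ge> 1" using newton A by (simp_all add: p_def q_def)
  have "(4 - 3 * p) * t = (4 * A1 * A3 - 3 * A2\<^sup>2) / (A1 * A4)"
    using A by (simp add: p_def t_def field_simps)
  also have "\<dots> \<le> (A0 * A4) / (A1 * A4)" using A quartic by (intro divide_right_mono) auto
  finally have e: "(4 - 3 * p) * t \<le> e" using A by (simp add: e_def)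
  have "(4 - 3 * q) * w = (4 * A2 * A4 - 3 * A3\<^sup>2) / (A1 * A4)"
    using A by (simp add: q_def w_def field_simps)
  also have "\<dots> \<le> (A1 * A5) / (A1 * A4)" using A quartic by (intro divide_right_mono) auto
  finally have f: "(4 - 3 * q) * w \<le> f" using A by (simp add: f_def)
  have tw: "t * w = p * q"
    using A by (simp add: p_def q_def t_def w_def field_simps power2_eq_square)
  \<comment> \<open>The second argument of each \<open>max\<close> comes from dropping the positive
    terms in \<open>e\<close> or \<open>f\<close>; it is the better bound once
    \<open>4 - 3 * p\<close> or \<open>4 - 3 * q\<close> is negative.\<close>
  define M N where "M = max (\<alpha> * (4 - 3 * p) + \<beta>) \<beta>" and "N = max (\<gamma> + \<delta> * (4 - 3 * q)) \<gamma>"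
  define X Y where "X = \<alpha> * e + \<beta> * t" and "Y = \<gamma> * w + \<delta> * f"
  have "t * (\<alpha> * (4 - 3 * p) + \<beta>) \<le> X"
    using mult_left_mono[OF e weights(1)] by (simp add: X_def algebra_simps)
  moreover have "t * \<beta> \<le> X" using weights pos by (simp add: X_def)
  ultimately have X: "t * M \<le> X" by (simp add: M_def max_def)
  have "w * (\<gamma> + \<delta> * (4 - 3 * q)) \<le> Y"
    using mult_left_mono[OF f weights(4)] by (simp add: Y_def algebra_simps)
  moreover have "w * \<gamma> \<le> Y" using weights pos by (simp add: Y_def)
  ultimately have Y: "w * N \<le> Y" by (simp add: N_def max_def)
  have MN: "M \<ge> 0" "N \<ge> 0" using weights by (auto simp: M_def N_def)
  have "m\<^sup>2 \<le> (p * M) * (q * N)"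
    using p_bound[OF pq(1)] q_bound[OF pq(2)] c
    by (intro order_trans[OF c(3)] mult_mono) (auto simp: M_def N_def)
  also have "\<dots> = (p * q) * (M * N)" by simp
  also have "\<dots> = (t * M) * (w * N)" by (simp flip: tw)
  also have "\<dots> \<le> X * Y" using X Y MN pos weights by (intro mult_mono) (auto simp: X_def)
  finally have "m\<^sup>2 \<le> X * Y" .
  \<comment> \<open>Arithmetic-geometric mean: \<open>X + Y\<close> is at least twice the square
    root of \<open>X * Y\<close>.\<close>
  moreover have "0 \<le> (X - Y)\<^sup>2" by simp
  ultimately have "(2 * m)\<^sup>2 \<le> (X + Y)\<^sup>2" by (simp add: power2_eq_square algebra_simps)
  moreover have "0 \<le> X + Y" using weights pos by (simp add: X_def Y_def)
  ultimately have "2 * m \<le> X + Y" by (rule power2_le_imp_le)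
  then show ?thesis
    by (simp add: X_def Y_def e_def w_def t_def f_def add_divide_distrib)
qed

section \<open>Weights that rule out a pattern\<close>

text \<open>The inequalities from the minus signs in degrees \<open>k + 2\<close> and
  \<open>k + 5\<close>, divided by \<open>s (k + 1)\<close> and \<open>s (k + 4)\<close> and
  weighted by \<open>a1\<close> and \<open>a4\<close>, bound strictly by \<open>2 * m\<close> the
  very sum that \<open>six_term_bound\<close> bounds below by \<open>2 * m\<close>.\<close>

lemma not_realizable_of_weights:
  fixes \<alpha> \<beta> \<gamma> \<delta> m c c' a1 a4 :: real
  assumes n: "k + 5 \<le> n"
    and signs: "\<sigma> ! (n - k) = -1" "\<sigma> ! (n - (k + 3)) = -1"
    and weights: "\<alpha> = a1 * real (n choose k)" "\<gamma> = a1 * real (n choose (k + 2))"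
      "\<beta> = a4 * real (n choose (k + 3))" "\<delta> = a4 * real (n choose (k + 5))"
      "m = a1 * real (n choose (k + 1)) + a4 * real (n choose (k + 4))" "a1 > 0" "a4 > 0"
    and p_bound: "\<And>p. p \<ge> 1 \<Longrightarrow> c \<le> p * max (\<alpha> * (4 - 3 * p) + \<beta>) \<beta>"
    and q_bound: "\<And>q. q \<ge> 1 \<Longrightarrow> c' \<le> q * max (\<gamma> + \<delta> * (4 - 3 * q)) \<gamma>"
    and c: "0 \<le> c" "0 \<le> c'" "m\<^sup>2 \<le> c * c'"
  shows "\<not> realizable (n + 2) \<sigma> 0 n"
proof
  assume "realizable (n + 2) \<sigma> 0 n"
  moreover have "n > 0" using n by simp
  ultimately obtain s :: "nat \<Rightarrow> real" where s: "\<And>k. k \<le> n \<Longrightarrow> s k > 0"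
    "\<And>k. k + 2 \<le> n \<Longrightarrow> s k * s (k + 2) \<le> (s (k + 1))\<^sup>2"
    "\<And>k. k + 4 \<le> n \<Longrightarrow> 4 * s (k + 1) * s (k + 3) - 3 * (s (k + 2))\<^sup>2 \<le> s k * s (k + 4)"
    "\<And>k. k + 2 \<le> n \<Longrightarrow> \<sigma> ! (n - k) = -1 \<Longrightarrow>
       real (n choose k) * s k + real (n choose (k + 2)) * s (k + 2)
         < 2 * real (n choose (k + 1)) * s (k + 1)"
    by (rule realizable_sequence) blast
  have "2 * m \<le> (\<alpha> * s k + \<gamma> * s (k + 2)) / s (k + 1)
      + (\<beta> * s (k + 3) + \<delta> * s (k + 5)) / s (k + 4)"
    using n s(1)[of k] s(1)[of "k+1"] s(1)[of "k+2"] s(1)[of "k+3"] s(1)[of "k+4"] s(1)[of "k+5"]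
      s(2)[of "k+1"] s(2)[of "k+2"] s(3)[of k] s(3)[of "k+1"] weights(6,7)
    by (intro six_term_bound[OF _ _ _ _ _ _ _ _ _ _ _ _ _ _ p_bound q_bound c])
      (simp_all add: weights(1-4) eval_nat_numeral del: binomial_Suc_Suc)
  moreover have "(\<alpha> * s k + \<gamma> * s (k + 2)) / s (k + 1) < 2 * a1 * real (n choose (k + 1))"
    using s(4)[of k] n signs(1) s(1)[of "k + 1"] mult_strict_left_mono[OF _ weights(6)]
    by (simp add: weights pos_divide_less_eq algebra_simps flip: distrib_left
        del: binomial_Suc_Suc)
  moreover have "(\<beta> * s (k + 3) + \<delta> * s (k + 5)) / s (k + 4)
      < 2 * a4 * real (n choose (k + 4))"
    using s(4)[of "k + 3"] n signs(2) s(1)[of "k + 4"] mult_strict_left_mono[OF _ weights(7)]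
    by (simp add: weights pos_divide_less_eq algebra_simps flip: distrib_left
        del: binomial_Suc_Suc)
  ultimately show False by (simp add: weights(5) algebra_simps)
qed

text \<open>Splits the range of \<open>p\<close> at \<open>y\<close>: up to \<open>y\<close> the
  first argument of \<open>max\<close> is used, beyond it the constant \<open>v\<close>
  suffices.\<close>

lemma le_mult_max:
  fixes p u v x y :: real
  assumes "0 \<le> p" "0 \<le> v" "x \<le> y * v" "p \<le> y \<Longrightarrow> x \<le> p * u"
  shows "x \<le> p * max u v"
proof (cases "p \<le> y")
  case True
  then have "x \<le> p * u" by (rule assms(4))
  also have "\<dots> \<le> p * max u v" using assms(1) by (intro mult_left_mono) auto
  finally show ?thesis .
next
  case False
  then have "y * v \<le> p * max u v" using assms(1,2) by (intro mult_mono) auto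
  with assms(3) show ?thesis by simp
qed

text \<open>
  \<open>\<alpha>\<close>, \<open>\<beta>\<close>, \<open>\<gamma>\<close> and \<open>\<delta>\<close> are chosen so that \<open>(\<alpha> + \<beta>) (\<gamma> + \<delta>) \<ge> m\<^sup>2\<close>: this is the bound at
  \<open>p = q = 1\<close>, where all roots of the degree \<open>n\<close> factor coincide.
\<close>

theorem proposition2:
  shows "\<not> realizable 9 (Sigma_pattern 3 4 3) 0 7
       \<and> \<not> realizable 9 (Sigma_pattern 2 4 4) 0 7
       \<and> \<not> realizable 10 (Sigma_pattern 2 4 5) 0 8"
proof (intro conjI)
  have "\<not> realizable (7 + 2) (Sigma_pattern 3 4 3) 0 7"
  \<comment> \<open>Here and below, \<open>k + 2\<close> is the degree of the lowest minus sign,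
    \<open>c = \<alpha> + \<beta>\<close> and \<open>c' = \<gamma> + \<delta>\<close>. This pattern
    is symmetric, hence the equal weights.\<close>
  proof (rule not_realizable_of_weights[where k = 1 and c = 6 and c' = 6 and m = 6 and
        ?a1.0 = "1/7" and ?a4.0 = "1/7" and \<alpha> = 1 and \<gamma> = 5 and \<beta> = 5 and \<delta> = 1])
    show "6 \<le> p * max (1 * (4 - 3 * p) + 5) 5" if "p \<ge> 1" for p :: real
      \<comment> \<open>The difference of the two sides is a concave quadratic in \<open>p\<close>
        with roots 1 and \<open>y\<close>; each later choice of \<open>y\<close> is likewise the
        second root.\<close>
      by (rule le_mult_max[where y = 2])
        (use that mult_nonneg_nonneg[of "p - 1" "2 - p"] in \<open>auto simp: algebra_simps\<close>)
    then show "6 \<le> q * max (5 + 1 * (4 - 3 * q)) 5" if "q \<ge> 1" for q :: real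
      using that by (simp add: algebra_simps)
  qed (simp_all add: Sigma_pattern_def eval_nat_numeral)
  then show "\<not> realizable 9 (Sigma_pattern 3 4 3) 0 7" by simp
  have "\<not> realizable (7 + 2) (Sigma_pattern 2 4 4) 0 7"
  proof (rule not_realizable_of_weights[where k = 2 and c = 27 and c' = 11 and m = 17 and
        ?a1.0 = "2/7" and ?a4.0 = 1 and \<alpha> = 6 and \<gamma> = 10 and \<beta> = 21 and \<delta> = 1])
    show "27 \<le> p * max (6 * (4 - 3 * p) + 21) 21" if "p \<ge> 1" for p :: real
      by (rule le_mult_max[where y = "3/2"])
        (use that mult_nonneg_nonneg[of "p - 1" "3 - 2 * p"] in \<open>auto simp: algebra_simps\<close>)
    show "11 \<le> q * max (10 + 1 * (4 - 3 * q)) 10" if "q \<ge> 1" for q :: real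
      by (rule le_mult_max[where y = "11/3"])
        (use that mult_nonneg_nonneg[of "q - 1" "11 - 3 * q"] in \<open>auto simp: algebra_simps\<close>)
  qed (simp_all add: Sigma_pattern_def eval_nat_numeral)
  then show "\<not> realizable 9 (Sigma_pattern 2 4 4) 0 7" by simp
  have "\<not> realizable (8 + 2) (Sigma_pattern 2 4 5) 0 8"
  proof (rule not_realizable_of_weights[where k = 3 and c = 18 and c' = "9/2" and m = 9 and
        ?a1.0 = "1/14" and ?a4.0 = "1/2" and \<alpha> = 4 and \<gamma> = 4 and \<beta> = 14 and \<delta> = "1/2"])
    show "18 \<le> p * max (4 * (4 - 3 * p) + 14) 14" if "p \<ge> 1" for p :: real
      by (rule le_mult_max[where y = "3/2"])
        (use that mult_nonneg_nonneg[of "p - 1" "3 - 2 * p"] in \<open>auto simp: algebra_simps\<close>)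
    show "9/2 \<le> q * max (4 + 1/2 * (4 - 3 * q)) 4" if "q \<ge> 1" for q :: real
      by (rule le_mult_max[where y = 3])
        (use that mult_nonneg_nonneg[of "q - 1" "3 - q"] in \<open>auto simp: algebra_simps\<close>)
  qed (simp_all add: Sigma_pattern_def eval_nat_numeral)
  then show "\<not> realizable 10 (Sigma_pattern 2 4 5) 0 8" by simp
qed

end
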